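(* Consider the problem $\mathbf{D_{SICD}}$: $$\max_{\tau_0,\mathbf{E}}\ \mathcal{L}(\mathbf{E},\tau_0,\lambda,\mu)\quad\text{subject to}\quad 0\le\tau_{0,t}\le 1\ \ \forall t,\qquad E_{i,t}\ge 0\ \ \forall i,\forall t,$$ where $$\mathcal{L}(\mathbf{E},\tau_0,\lambda,\mu)=\sum_{t=1}^{T}\sum_{i=1}^{K}R_{i,t}+\sum_{i=1}^{K}\sum_{n=1}^{T}\lambda_{i,n}\left(\sum_{t=1}^{n}\left(\gamma_{i,t}\tau_{0,t}-E_{i,t}\right)\right)+\sum_{i=1}^{K}\sum_{t=1}^{T}\mu_{i,t}\left(x_{i,t}-S_i^{th}\right).$$ Given $\lambda$ and $\mu$, the optimal time and energy allocations of $\mathbf{D_{SICD}}$ are given by $$\tau_{0,t}^*=\min\left[\left(1-\frac{\sum_{i=1}^{K}g_{i,t}E_{i,t}}{z_t^*\sigma^2}\right)^+,1\right],$$ $$E_{i,t}^*=\left(\frac{(1-\tau_{0,t})(g_{i,t}-\sigma^2a_{i,t})}{a_{i,t}g_{i,t}}-\frac{1}{g_{i,t}}\sum_{j\ge i}^{K}g_{i,t}E_{i,t}\right)^+,$$ where $$a_{i,t}=\ln(2)\left(\sum_{n=t}^{T}\lambda_{i,n}+g_{i,t}\,\chi\{i\ge 2\}\sum_{j=1}^{i-1}\mu_{j,t}S_j^{th}-\mu_{i,t}g_{i,t}\right),$$ and $z_t^*$ is the unique solution $z_t\ge 0$ of $f(z_t)=b^{(t)}$, with $$f(z_t)=\ln(1+z_t)-\frac{z_t}{1+z_t},\qquad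 b^{(t)}=\ln(2)\left(\sigma^2\sum_{i=1}^{K}\mu_{i,t}S_i^{th}+\sum_{i=1}^{K}\sum_{n=t}^{T}\lambda_{i,n}\gamma_{i,t}\right).$$
   Context: Notation: $(\cdot)^+=\max\{0,\cdot\}$ and $\chi\{\cdot\}$ is the indicator function; $\tau_0=(\tau_{0,t})_t$, $\mathbf{E}=(E_{i,t})_{i,t}$, $\lambda=(\lambda_{i,t})_{i,t}$, $\mu=(\mu_{i,t})_{i,t}$, with $i=1,\dots,K$ and $t=1,\dots,T$. Empty sums are zero. A wireless powered communication network has $K$ users, an energy-rich node, an access point, and $T$ time slots of unit length. In slot $t$ the users harvest energy for a duration $\tau_{0,t}$ and all transmit simultaneously to the access point during the remaining $1-\tau_{0,t}$. User $i$ harvests energy $\gamma_{i,t}\tau_{0,t}$ in slot $t$, where $\gamma_{i,t}=\eta_i h_{i,t}P_B$ ($\eta_i$ harvesting efficiency, $h_{i,t}$ downlink channel power gain, $P_B$ average transmit power of the energy-rich node), and uses energy $E_{i,t}$; $g_{i,t}$ is its uplink channel power gain, $\sigma^2$ is the noise power at the access point, and $S_i^{th}$ is the decoding threshold of user $i$. Under successive interference cancellation decoding (SICD), each decoded signal is removed from the interference of the users decoded next, in the order $1,\dots,K$, so that the signal-to-interference-and-noise ratio and the throughput of user $i$ in slot $t$ are $$x_{i,t}=\frac{g_{i,t}E_{i,t}}{\sigma^2(1-\tau_{0,t})+\sum_{j=i+1}^{K}g_{j,t}E_{j,t}},\qquad R_{i,t}=(1-\tau_{0,t})\log_2(1+x_{i,t}).$$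 $\mathcal{L}$ is the Lagrangian of the problem of maximizing $\sum_{t=1}^{T}\sum_{i=1}^{K}R_{i,t}$ subject to the energy causality constraints $\sum_{n=1}^{t}E_{i,n}\le\sum_{n=1}^{t}\gamma_{i,n}\tau_{0,n}$, the decoding constraints $x_{i,t}\ge S_i^{th}$, and $0\le\tau_{0,t}\le 1$, $E_{i,t}\ge 0$; $\lambda_{i,t}$ and $\mu_{i,t}$ are the dual variables associated with the energy causality and decoding constraints, respectively.
   Formalization: In E* the sum over j≥i of g_{i,t}E_{i,t} is corrected to the sum over j≠i of g_{j,t}E_{j,t}. As the given Lagrangian has no maximizer if some μ_{i,t}>0, the claim is also shown with x≥S multiplied by its denominator. The converse is shown for all τ_{0,t}<1. *)

theory Defs
  imports Complex_Main
begin

text \<open>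
  Users are indexed by \<open>1..users N\<close> and slots by \<open>1..slots N\<close>; values outside these ranges are
  irrelevant. The field \<open>noise\<close> is the noise power, i.e. the quantity written sigma squared.
\<close>

record wpcn =
  users :: nat
  slots :: nat
  eff :: "nat \<Rightarrow> real"
  dl_gain :: "nat \<Rightarrow> nat \<Rightarrow> real"
  ul_gain :: "nat \<Rightarrow> nat \<Rightarrow> real"
  power :: real
  noise :: real
  thr :: "nat \<Rightarrow> real"

definition wf_wpcn :: "wpcn \<Rightarrow> bool" where
  "wf_wpcn N \<longleftrightarrow>
     1 \<le> users N \<and> 0 < power N \<and> 0 < noise N \<and>
     (\<forall>i\<in>{1..users N}. 0 < eff N i \<and> 0 \<le> thr N i \<and>
        (\<forall>t\<in>{1..slots N}. 0 < dl_gain N i t \<and> 0 < ul_gain N i t))"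

definition harvest_rate :: "wpcn \<Rightarrow> nat \<Rightarrow> nat \<Rightarrow> real" where
  "harvest_rate N i t = eff N i * dl_gain N i t * power N"

definition interference ::
  "wpcn \<Rightarrow> (nat \<Rightarrow> nat \<Rightarrow> real) \<Rightarrow> (nat \<Rightarrow> real) \<Rightarrow> nat \<Rightarrow> nat \<Rightarrow> real" where
  "interference N E tau i t =
     noise N * (1 - tau t) + (\<Sum>j=i+1..users N. ul_gain N j t * E j t)"

text \<open>
  If \<open>tau t = 1\<close> the denominator can vanish; the value is then \<open>0\<close>, and \<open>rate\<close> has its
  continuous extension \<open>0\<close>.
\<close>

definition sinr ::
  "wpcn \<Rightarrow> (nat \<Rightarrow> nat \<Rightarrow> real) \<Rightarrow> (nat \<Rightarrow> real) \<Rightarrow> nat \<Rightarrow> nat \<Rightarrow> real" where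
  "sinr N E tau i t = ul_gain N i t * E i t / interference N E tau i t"

definition rate ::
  "wpcn \<Rightarrow> (nat \<Rightarrow> nat \<Rightarrow> real) \<Rightarrow> (nat \<Rightarrow> real) \<Rightarrow> nat \<Rightarrow> nat \<Rightarrow> real" where
  "rate N E tau i t = (1 - tau t) * log 2 (1 + sinr N E tau i t)"

definition feasible :: "wpcn \<Rightarrow> (nat \<Rightarrow> nat \<Rightarrow> real) \<Rightarrow> (nat \<Rightarrow> real) \<Rightarrow> bool" where
  "feasible N E tau \<longleftrightarrow>
     (\<forall>t\<in>{1..slots N}. 0 \<le> tau t \<and> tau t \<le> 1) \<and>
     (\<forall>i\<in>{1..users N}. \<forall>t\<in>{1..slots N}. 0 \<le> E i t)"

definition lagrangian_base ::
  "wpcn \<Rightarrow> (nat \<Rightarrow> nat \<Rightarrow> real) \<Rightarrow> (nat \<Rightarrow> nat \<Rightarrow> real) \<Rightarrow> (nat \<Rightarrow> real) \<Rightarrow> real" where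
  "lagrangian_base N lam E tau =
     (\<Sum>t=1..slots N. \<Sum>i=1..users N. rate N E tau i t) +
     (\<Sum>i=1..users N. \<Sum>n=1..slots N.
        lam i n * (\<Sum>t=1..n. harvest_rate N i t * tau t - E i t))"

definition lagrangian ::
  "wpcn \<Rightarrow> (nat \<Rightarrow> nat \<Rightarrow> real) \<Rightarrow> (nat \<Rightarrow> nat \<Rightarrow> real) \<Rightarrow>
   (nat \<Rightarrow> nat \<Rightarrow> real) \<Rightarrow> (nat \<Rightarrow> real) \<Rightarrow> real" where
  "lagrangian N lam mu E tau = lagrangian_base N lam E tau +
     (\<Sum>i=1..users N. \<Sum>t=1..slots N. mu i t * (sinr N E tau i t - thr N i))"

text \<open>
  The same Lagrangian with the decoding constraint \<open>sinr \<ge> thr\<close> multiplied by its denominator.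
  Its partial derivatives are the ones that produce the coefficients \<open>energy_coeff\<close> and
  \<open>time_coeff\<close> below for arbitrary \<open>mu\<close>. The fractional form \<open>lagrangian\<close> is unbounded above on
  the feasible set (let \<open>tau t\<close> tend to \<open>1\<close>) as soon as some \<open>mu i t\<close> is positive.
\<close>

definition lagrangian_cleared ::
  "wpcn \<Rightarrow> (nat \<Rightarrow> nat \<Rightarrow> real) \<Rightarrow> (nat \<Rightarrow> nat \<Rightarrow> real) \<Rightarrow>
   (nat \<Rightarrow> nat \<Rightarrow> real) \<Rightarrow> (nat \<Rightarrow> real) \<Rightarrow> real" where
  "lagrangian_cleared N lam mu E tau = lagrangian_base N lam E tau +
     (\<Sum>i=1..users N. \<Sum>t=1..slots N.
        mu i t * (ul_gain N i t * E i t - thr N i * interference N E tau i t))"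

definition optimal ::
  "wpcn \<Rightarrow> ((nat \<Rightarrow> nat \<Rightarrow> real) \<Rightarrow> (nat \<Rightarrow> real) \<Rightarrow> real) \<Rightarrow>
   (nat \<Rightarrow> nat \<Rightarrow> real) \<Rightarrow> (nat \<Rightarrow> real) \<Rightarrow> bool" where
  "optimal N L E tau \<longleftrightarrow>
     is_arg_max (\<lambda>(E, tau). L E tau) (\<lambda>(E, tau). feasible N E tau) (E, tau)"

definition energy_coeff ::
  "wpcn \<Rightarrow> (nat \<Rightarrow> nat \<Rightarrow> real) \<Rightarrow> (nat \<Rightarrow> nat \<Rightarrow> real) \<Rightarrow> nat \<Rightarrow> nat \<Rightarrow> real" where
  "energy_coeff N lam mu i t = ln 2 *
     ((\<Sum>n=t..slots N. lam i n)
      + ul_gain N i t * of_bool (2 \<le> i) * (\<Sum>j=1..i-1. mu j t * thr N j)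
      - mu i t * ul_gain N i t)"

definition time_coeff ::
  "wpcn \<Rightarrow> (nat \<Rightarrow> nat \<Rightarrow> real) \<Rightarrow> (nat \<Rightarrow> nat \<Rightarrow> real) \<Rightarrow> nat \<Rightarrow> real" where
  "time_coeff N lam mu t = ln 2 *
     (noise N * (\<Sum>i=1..users N. mu i t * thr N i)
      + (\<Sum>i=1..users N. \<Sum>n=t..slots N. lam i n * harvest_rate N i t))"

definition f_aux :: "real \<Rightarrow> real" where
  "f_aux z = ln (1 + z) - z / (1 + z)"

definition z_star ::
  "wpcn \<Rightarrow> (nat \<Rightarrow> nat \<Rightarrow> real) \<Rightarrow> (nat \<Rightarrow> nat \<Rightarrow> real) \<Rightarrow> nat \<Rightarrow> real" where
  "z_star N lam mu t = (THE z. 0 \<le> z \<and> f_aux z = time_coeff N lam mu t)"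

definition time_formula ::
  "wpcn \<Rightarrow> (nat \<Rightarrow> nat \<Rightarrow> real) \<Rightarrow> (nat \<Rightarrow> nat \<Rightarrow> real) \<Rightarrow>
   (nat \<Rightarrow> nat \<Rightarrow> real) \<Rightarrow> nat \<Rightarrow> real" where
  "time_formula N lam mu E t =
     min (max 0 (1 - (\<Sum>i=1..users N. ul_gain N i t * E i t) / (z_star N lam mu t * noise N))) 1"

text \<open>
  Under successive interference cancellation the rates of a slot add up to
  \<open>(1 - tau t) * log 2 (1 + (\<Sum>j. ul_gain N j t * E j t) / (noise N * (1 - tau t)))\<close>,
  so stationarity in \<open>E i t\<close> involves the received energies of all the other users: the last sum
  ranges over \<open>j \<noteq> i\<close>, not only over the users decoded after \<open>i\<close>.
\<close>

definition energy_formula ::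
  "wpcn \<Rightarrow> (nat \<Rightarrow> nat \<Rightarrow> real) \<Rightarrow> (nat \<Rightarrow> nat \<Rightarrow> real) \<Rightarrow>
   (nat \<Rightarrow> nat \<Rightarrow> real) \<Rightarrow> (nat \<Rightarrow> real) \<Rightarrow> nat \<Rightarrow> nat \<Rightarrow> real" where
  "energy_formula N lam mu E tau i t =
     max 0 ((1 - tau t) * (ul_gain N i t - noise N * energy_coeff N lam mu i t)
              / (energy_coeff N lam mu i t * ul_gain N i t)
            - 1 / ul_gain N i t * (\<Sum>j\<in>{1..users N} - {i}. ul_gain N j t * E j t))"

text \<open>
  The formulas form a coupled system. The positivity of \<open>z_star\<close> and \<open>energy_coeff\<close> is part of
  the definition because both occur as divisors.
\<close>

definition closed_form ::
  "wpcn \<Rightarrow> (nat \<Rightarrow> nat \<Rightarrow> real) \<Rightarrow> (nat \<Rightarrow> nat \<Rightarrow> real) \<Rightarrow>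
   (nat \<Rightarrow> nat \<Rightarrow> real) \<Rightarrow> (nat \<Rightarrow> real) \<Rightarrow> bool" where
  "closed_form N lam mu E tau \<longleftrightarrow>
     (\<forall>t\<in>{1..slots N}. 0 < z_star N lam mu t \<and> tau t = time_formula N lam mu E t) \<and>
     (\<forall>i\<in>{1..users N}. \<forall>t\<in>{1..slots N}.
        0 < energy_coeff N lam mu i t \<and> E i t = energy_formula N lam mu E tau i t)"

end

theory Submission
  imports Defs
begin

text \<open>
  Write \<open>s = 1 - tau t\<close>, \<open>c\<close> for the noise power and \<open>U\<close> for the total received energy of a slot.
  Successive cancellation makes the rates of a slot telescope to \<open>s * log 2 (1 + U / (c * s))\<close>, and
  in the cleared Lagrangian everything else is linear. Exchanging the order of summation (energy
  causality over slots, interference over users) collects the linear terms into \<open>energy_coeff\<close> and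
  \<open>time_coeff\<close>, so that, up to a constant and the factor \<open>ln 2\<close>, the Lagrangian is a sum of
  independent slot payoffs \<open>s * ln (1 + U / (c * s)) - b * s - (\<Sum>i. a i * e i)\<close>
  (\<open>lagrangian_cleared_slots\<close>, \<open>optimal_cleared_iff_slot_best\<close>).

  The nonlinear term is concave and positively homogeneous in \<open>(s, U)\<close>. Its tangent plane along the
  ray \<open>U = c * s * x\<close> is \<open>s * f_aux x + U / (c * (1 + x))\<close>, it dominates the term everywhere, and it
  touches it only on that ray (\<open>persp_less_tangent\<close>). This replaces all differential calculus.
  For necessity, each closed formula names the unique maximizer when only one variable varies: choose
  \<open>x\<close> as the signal-to-noise ratio at the formula's value, and every other value loses strictly
  (\<open>best_duration\<close>, \<open>best_energy\<close>). For sufficiency, one tangent plane at a solution of the coupled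
  system bounds all competitors at once (\<open>best_if_stationary\<close>); the condition \<open>tau t < 1\<close>
  provides the ray that determines \<open>x\<close>. The divisors are positive at an optimum because a user with
  a nonpositive energy price could increase the payoff without bound, and a positive price of user 1
  forces a positive time coefficient.

  The fractional Lagrangian has no maximizer when some multiplier \<open>mu i t\<close> is positive: transmitting
  one unit of energy in an ever shorter time drives that user's ratio to infinity. If all those
  multipliers vanish, both Lagrangians agree.
\<close>

section \<open>The function \<open>f_aux\<close> and the perspective of the logarithm\<close>

definition persp :: "real \<Rightarrow> real \<Rightarrow> real \<Rightarrow> real" where
  "persp c s U = s * ln (1 + U / (c * s))"

lemma persp_eq_tangent:
  assumes "0 < c" "0 \<le> s" "0 \<le> x"
  shows "persp c s (c * s * x) = s * f_aux x + c * s * x / (c * (1 + x))"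
proof (cases "s = 0")
  case False
  have "c * s * x / (c * (1 + x)) = s * (x / (1 + x))" using assms by simp
  with False show ?thesis using assms by (simp add: persp_def f_aux_def right_diff_distrib)
qed (simp add: persp_def)

text \<open>
  Dividing by \<open>s\<close> turns the claim into the strict tangent inequality for \<open>ln\<close> at \<open>1 + x\<close>. For \<open>s = 0\<close>
  the ray degenerates to \<open>U = 0\<close>, and off it the right-hand side is positive while
  \<open>persp c 0 U = 0\<close>; so the convention at duration zero causes no exception.
\<close>

lemma persp_less_tangent:
  assumes c: "0 < c" and s: "0 \<le> s" and U: "0 \<le> U" and x: "0 \<le> x" and ne: "U \<noteq> c * s * x"
  shows "persp c s U < s * f_aux x + U / (c * (1 + x))"
proof (cases "s = 0")
  case True
  then have "0 < U" using U ne by simp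
  then show ?thesis using True c x by (simp add: persp_def)
next
  case False
  then have s: "0 < s" using s by simp
  define y where "y = U / (c * s)"
  have y: "0 \<le> y" and Uy: "U = c * s * y" using c s U by (auto simp: y_def)
  define r where "r = (1 + y) / (1 + x)"
  have r: "0 < r" using x y by (simp add: r_def)
  have "r \<noteq> 1" using ne Uy x by (auto simp: r_def)
  then have "ln r < r - 1"
    using ln_le_minus_one[OF r] ln_eq_minus_one[OF r] by fastforce
  moreover have "ln r = ln (1 + y) - ln (1 + x)"
    using x y by (simp add: r_def ln_div)
  moreover have "r - 1 = y / (1 + x) - x / (1 + x)"
    using x by (simp add: r_def diff_divide_eq_iff divide_diff_eq_iff flip: diff_divide_distrib)
  ultimately have "ln (1 + y) < f_aux x + y / (1 + x)" by (simp add: f_aux_def)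
  then have "s * ln (1 + y) < s * (f_aux x + y / (1 + x))" using s by simp
  moreover have "s * (f_aux x + y / (1 + x)) = s * f_aux x + U / (c * (1 + x))"
  proof -
    have "U / (c * (1 + x)) = s * (y / (1 + x))" using c by (simp add: Uy)
    then show ?thesis by (simp only: distrib_left)
  qed
  ultimately show ?thesis by (simp add: persp_def y_def)
qed

lemma persp_le_tangent:
  assumes "0 < c" "0 \<le> s" "0 \<le> U" "0 \<le> x"
  shows "persp c s U \<le> s * f_aux x + U / (c * (1 + x))"
  using persp_less_tangent[OF assms] persp_eq_tangent[OF assms(1,2,4)]
  by (cases "U = c * s * x") auto

lemma f_aux_strict_mono:
  assumes "0 \<le> x" "x < y"
  shows "f_aux x < f_aux y"
proof -
  \<comment> \<open>The tangent at \<open>y\<close> lies strictly above the logarithm at \<open>x\<close>.\<close>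
  have "persp 1 1 x < 1 * f_aux y + x / (1 * (1 + y))"
    using assms by (intro persp_less_tangent) auto
  then have "ln (1 + x) < f_aux y + x / (1 + y)" by (simp add: persp_def)
  moreover have "x / (1 + y) \<le> x / (1 + x)" using assms by (intro divide_left_mono) auto
  ultimately show ?thesis by (simp add: f_aux_def)
qed

lemma f_aux_mono: "0 \<le> x \<Longrightarrow> x \<le> y \<Longrightarrow> f_aux x \<le> f_aux y"
  using f_aux_strict_mono[of x y] by (cases "x = y") auto

lemma f_aux_0 [simp]: "f_aux 0 = 0"
  by (simp add: f_aux_def)

lemma ex1_f_aux:
  assumes "0 \<le> b"
  shows "\<exists>!z. 0 \<le> z \<and> f_aux z = b"
proof -
  \<comment> \<open>Since \<open>z / (1 + z)\<close> is at most 1, \<open>f_aux z \<ge> b\<close> once \<open>ln (1 + z) = b + 1\<close>.\<close>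
  define w where "w = exp (b + 1) - 1"
  have w: "0 \<le> w" using assms by (simp add: w_def)
  have "w / (1 + w) \<le> 1" using w by simp
  then have fw: "b \<le> f_aux w" unfolding f_aux_def by (simp add: w_def)
  have "\<exists>z\<ge>0. z \<le> w \<and> f_aux z = b"
  proof (rule IVT')
    show "continuous_on {0..w} f_aux" unfolding f_aux_def
      by (intro continuous_intros) auto
  qed (use assms w fw in auto)
  then show ?thesis using f_aux_strict_mono by (metis linorder_neqE_linordered_idom order_less_irrefl)
qed

section \<open>Optimal allocation in a single slot\<close>

text \<open>
  The data of one slot: uplink gains \<open>g\<close>, noise power \<open>c\<close>, and the prices \<open>a i\<close> of user \<open>i\<close>'s energy and
  \<open>b\<close> of transmission time. The energy prices may have any sign: their positivity is a consequence of
  the existence of an optimum.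
\<close>

locale sic_slot =
  fixes I :: "'i set" and g a :: "'i \<Rightarrow> real" and c b :: real
  assumes fin: "finite I" and g_pos: "\<And>i. i \<in> I \<Longrightarrow> 0 < g i" and c_pos: "0 < c"
begin

definition received :: "('i \<Rightarrow> real) \<Rightarrow> real" where
  "received e = (\<Sum>i\<in>I. g i * e i)"

definition payoff :: "('i \<Rightarrow> real) \<Rightarrow> real \<Rightarrow> real" where
  "payoff e s = persp c s (received e) - b * s - (\<Sum>i\<in>I. a i * e i)"

definition admissible :: "('i \<Rightarrow> real) \<Rightarrow> real \<Rightarrow> bool" where
  "admissible e s \<longleftrightarrow> 0 \<le> s \<and> s \<le> 1 \<and> (\<forall>i\<in>I. 0 \<le> e i)"

definition best :: "('i \<Rightarrow> real) \<Rightarrow> real \<Rightarrow> bool" where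
  "best e s \<longleftrightarrow> admissible e s \<and> (\<forall>e' s'. admissible e' s' \<longrightarrow> payoff e' s' \<le> payoff e s)"

definition energy_update :: "('i \<Rightarrow> real) \<Rightarrow> real \<Rightarrow> 'i \<Rightarrow> real" where
  "energy_update e s i =
     max 0 (s * (g i - c * a i) / (a i * g i) - 1 / g i * (\<Sum>j\<in>I - {i}. g j * e j))"

lemma received_nonneg: "admissible e s \<Longrightarrow> 0 \<le> received e"
  unfolding received_def admissible_def using g_pos by (auto intro!: sum_nonneg intro: mult_nonneg_nonneg less_imp_le)

lemma received_remove:
  assumes "i \<in> I"
  shows "received e = g i * e i + (\<Sum>j\<in>I - {i}. g j * e j)"
  unfolding received_def using fin assms by (simp add: sum.remove)

lemma received_upd:
  assumes "i \<in> I"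
  shows "received (e(i := y)) = g i * y + (\<Sum>j\<in>I - {i}. g j * e j)"
  using received_remove[OF assms, of "e(i := y)"] by simp

lemma cost_upd:
  assumes "i \<in> I"
  shows "(\<Sum>j\<in>I. a j * (e(i := y)) j) = a i * y + (\<Sum>j\<in>I - {i}. a j * e j)"
  using fin assms by (simp add: sum.remove)

text \<open>
  With a full slot and a single active user whose energy price is not positive, the logarithm makes the payoff
  arbitrarily large, so no optimum exists.
\<close>

lemma energy_price_pos:
  assumes "best e s" and i: "i \<in> I"
  shows "0 < a i"
proof (rule ccontr)
  assume "\<not> 0 < a i"
  \<comment> \<open>The energy for which the logarithm exceeds the optimal payoff plus \<open>b\<close>.\<close>
  define y where "y = c * (exp (\<bar>payoff e s\<bar> + \<bar>b\<bar> + 1) - 1) / g i"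
  define e' where "e' = (\<lambda>_. 0::real)(i := y)"
  have y: "0 \<le> y" using c_pos g_pos[OF i] by (auto simp: y_def)
  then have adm: "admissible e' 1" by (auto simp: admissible_def e'_def)
  have "g i * y / c = exp (\<bar>payoff e s\<bar> + \<bar>b\<bar> + 1) - 1"
    using c_pos g_pos[OF i] by (simp add: y_def)
  then have "persp c 1 (received e') = \<bar>payoff e s\<bar> + \<bar>b\<bar> + 1"
    by (simp add: persp_def e'_def received_upd[OF i])
  moreover have "(\<Sum>j\<in>I. a j * e' j) \<le> 0"
    unfolding e'_def cost_upd[OF i] using \<open>\<not> 0 < a i\<close> y by (simp add: mult_nonpos_nonneg)
  ultimately have "payoff e s < payoff e' 1" by (simp add: payoff_def)
  with assms adm show False by (force simp: best_def)
qed

text \<open>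
  With the energies fixed, take the tangent along the ray through the claimed duration. Its slope in
  \<open>s\<close> is \<open>f_aux x - b\<close>, which vanishes if the bound 1 is inactive (then \<open>x = z\<close>) and is nonnegative
  otherwise (then \<open>z \<le> x\<close>), so no other duration reaches the same payoff. If no energy is
  received there is no such ray, but then transmission time only costs.
\<close>

lemma best_duration:
  assumes best: "best e s" and b: "0 < b" and z: "0 < z" "f_aux z = b"
  shows "s = min 1 (received e / (z * c))"
proof (rule ccontr)
  define U where "U = received e"
  define s' where "s' = min 1 (U / (z * c))"
  assume "s \<noteq> min 1 (received e / (z * c))"
  then have ne: "s \<noteq> s'" by (simp add: s'_def U_def)
  have adm: "admissible e s" using best by (simp add: best_def)
  then have s: "0 \<le> s" "s \<le> 1" by (auto simp: admissible_def)
  have U: "0 \<le> U" using received_nonneg[OF adm] by (simp add: U_def)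
  have s': "0 \<le> s'" "s' \<le> 1" using U z c_pos by (auto simp: s'_def)
  then have "admissible e s'" using adm by (simp add: admissible_def)
  then have le: "persp c s' U - b * s' \<le> persp c s U - b * s"
    using best by (fastforce simp: best_def payoff_def U_def)
  show False
  proof (cases "U = 0")
    case True
    then show False using le b ne s by (auto simp: persp_def s'_def mult_le_0_iff)
  next
    case False
    then have Upos: "0 < U" using U by simp
    have spos: "0 < s'" using Upos z c_pos by (simp add: s'_def)
    define x where "x = U / (c * s')"
    have x: "0 < x" and Ux: "U = c * s' * x" using Upos spos c_pos by (auto simp: x_def)
    have "s * (f_aux x - b) \<le> s' * (f_aux x - b)"
    proof (cases "U / (z * c) < 1")
      case True
      then have "x = z" using Upos z c_pos by (simp add: x_def s'_def)
      then show ?thesis using z by simp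
    next
      case False
      then have "s' = 1" "z * c \<le> U" using z c_pos by (auto simp: s'_def field_simps)
      then have "z \<le> x" using c_pos by (simp add: x_def field_simps)
      then have "b \<le> f_aux x" using f_aux_mono[of z x] z by simp
      then show ?thesis using \<open>s' = 1\<close> s mult_right_mono[of s 1 "f_aux x - b"] by simp
    qed
    moreover have "persp c s U < s * f_aux x + U / (c * (1 + x))"
      using c_pos s U x ne Ux by (intro persp_less_tangent) auto
    moreover have "persp c s' U = s' * f_aux x + U / (c * (1 + x))"
      using persp_eq_tangent[of c s' x] c_pos s' x Ux by simp
    ultimately show False using le by (simp add: algebra_simps)
  qed
qed

text \<open>
  The complementary slackness conditions of user \<open>i\<close>: at the updated energy the marginal rate is at most
  the price, with equality if the energy is positive. Solving \<open>g i / (c * (1 + x)) = a i\<close> for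
  the energy gives the expression inside the maximum.
\<close>

lemma energy_update_slope:
  assumes i: "i \<in> I" and a: "0 < a i" and s: "0 < s" and e: "\<forall>j\<in>I. 0 \<le> e j"
  defines "y \<equiv> energy_update e s i"
  defines "x \<equiv> received (e(i := y)) / (c * s)"
  shows "0 \<le> x" and "g i / (c * (1 + x)) \<le> a i" and "(g i / (c * (1 + x)) - a i) * y = 0"
proof -
  define V where "V = (\<Sum>j\<in>I - {i}. g j * e j)"
  have g: "0 < g i" using g_pos[OF i] .
  have V: "0 \<le> V" unfolding V_def using e g_pos
    by (intro sum_nonneg mult_nonneg_nonneg) (auto intro: less_imp_le)
  define w where "w = s * (g i - c * a i) / (a i * g i) - V / g i"
  have y: "y = max 0 w" by (simp add: y_def energy_update_def w_def V_def)
  have x: "x = (g i * y + V) / (c * s)" by (simp add: x_def received_upd[OF i] V_def)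
  show "0 \<le> x" using V g y s c_pos by (simp add: x)
  have cx: "c * (1 + x) * s = c * s + g i * y + V" using s c_pos by (simp add: x field_simps)
  have gw: "c * s + g i * w + V = s * g i / a i" using g a by (simp add: w_def field_simps)
  have pos: "0 < c * (1 + x)" using \<open>0 \<le> x\<close> c_pos by simp
  have ge: "s * g i / a i \<le> c * (1 + x) * s"
    unfolding cx gw[symmetric] using g by (simp add: y)
  then have "s * g i \<le> s * (a i * (c * (1 + x)))" using a by (simp add: field_simps)
  then have "g i \<le> a i * (c * (1 + x))" using s by (simp only: mult_le_cancel_left_pos)
  then show "g i / (c * (1 + x)) \<le> a i" using pos by (simp add: pos_divide_le_eq)
  show "(g i / (c * (1 + x)) - a i) * y = 0"
  proof (cases "0 < w")
    case True
    then have "s * g i / a i = c * (1 + x) * s" unfolding cx gw[symmetric] by (simp add: y)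
    then have "s * g i = s * (a i * (c * (1 + x)))" using a by (simp add: field_simps)
    then have "g i = a i * (c * (1 + x))" using s by (simp only: mult_cancel_left) simp
    then have "g i / (c * (1 + x)) = a i" using pos by (metis nonzero_eq_divide_eq order_less_irrefl)
    then show ?thesis by simp
  qed (simp add: y)
qed

text \<open>
  The tangent along the ray through the updated energy is an affine bound whose slope in user \<open>i\<close>'s
  energy satisfies \<open>energy_update_slope\<close>, so any other energy is strictly worse. At duration
  zero there is no ray, but then energy only costs.
\<close>

lemma best_energy:
  assumes best: "best e s" and i: "i \<in> I"
  shows "e i = energy_update e s i"
proof (rule ccontr)
  assume ne: "e i \<noteq> energy_update e s i"
  define y where "y = energy_update e s i"
  define e' where "e' = e(i := y)"
  have a: "0 < a i" using energy_price_pos[OF best i] .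
  have g: "0 < g i" using g_pos[OF i] .
  have adm: "admissible e s" using best by (simp add: best_def)
  then have s: "0 \<le> s" and e: "\<And>j. j \<in> I \<Longrightarrow> 0 \<le> e j" by (auto simp: admissible_def)
  have y: "0 \<le> y" by (simp add: y_def energy_update_def)
  have adm': "admissible e' s" using adm y by (auto simp: admissible_def e'_def)
  have cost: "(\<Sum>j\<in>I. a j * e j) = a i * e i + (\<Sum>j\<in>I - {i}. a j * e j)"
    using cost_upd[OF i, of e "e i"] by simp
  have cost': "(\<Sum>j\<in>I. a j * e' j) = a i * y + (\<Sum>j\<in>I - {i}. a j * e j)"
    unfolding e'_def by (rule cost_upd[OF i])
  have "payoff e' s \<le> payoff e s" using best adm' by (simp add: best_def)
  then have le: "persp c s (received e') - a i * y \<le> persp c s (received e) - a i * e i"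
    unfolding payoff_def cost cost' by simp
  show False
  proof (cases "s = 0")
    case True
    have "0 \<le> (\<Sum>j\<in>I - {i}. g j * e j)" using e g_pos
      by (intro sum_nonneg mult_nonneg_nonneg) (auto intro: less_imp_le)
    then have "y = 0" using True g by (simp add: y_def energy_update_def)
    then show False using le True a ne e[OF i] by (auto simp: persp_def y_def mult_le_0_iff)
  next
    case False
    then have s: "0 < s" using s by simp
    define x where "x = received e' / (c * s)"
    have "\<forall>j\<in>I. 0 \<le> e j" using e by blast
    note slope = energy_update_slope[OF i a s this, folded y_def, folded e'_def, folded x_def]
    have R': "received e' = c * s * x" using s c_pos by (simp add: x_def)
    have diff: "received e = received e' + g i * (e i - y)"
      unfolding e'_def received_upd[OF i] received_remove[OF i, of e] by (simp add: algebra_simps)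
    have "received e \<noteq> c * s * x" using diff R' ne g by (simp add: y_def)
    then have "persp c s (received e) < s * f_aux x + received e / (c * (1 + x))"
      using c_pos s received_nonneg[OF adm] slope by (intro persp_less_tangent) auto
    moreover have "persp c s (received e') = s * f_aux x + received e' / (c * (1 + x))"
      using persp_eq_tangent[of c s x] c_pos s slope R' by simp
    moreover have "received e / (c * (1 + x)) =
        received e' / (c * (1 + x)) + g i / (c * (1 + x)) * (e i - y)"
      unfolding diff by (simp add: add_divide_distrib)
    ultimately have "0 < (g i / (c * (1 + x)) - a i) * (e i - y)"
      using le by (simp add: algebra_simps)
    moreover have "(g i / (c * (1 + x)) - a i) * (e i - y) = (g i / (c * (1 + x)) - a i) * e i"
      using slope(3) by (simp add: right_diff_distrib)
    moreover have "(g i / (c * (1 + x)) - a i) * e i \<le> 0"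
      using slope(2) e[OF i] by (simp add: mult_nonpos_nonneg)
    ultimately show False by linarith
  qed
qed

text \<open>
  A single tangent plane, along the ray through \<open>(s, received e)\<close>, bounds the payoff of all competitors
  by an affine function, and the stationarity conditions say that this function is maximal at
  the given allocation, where it equals the payoff.
\<close>

lemma best_if_stationary:
  assumes a: "\<And>i. i \<in> I \<Longrightarrow> 0 < a i" and z: "0 < z" "f_aux z = b"
    and s: "0 < s" "s = min 1 (received e / (z * c))"
    and e: "\<And>i. i \<in> I \<Longrightarrow> e i = energy_update e s i"
  shows "best e s"
proof -
  have e0: "\<forall>i\<in>I. 0 \<le> e i"
  proof
    show "0 \<le> e i" if "i \<in> I" for i using e[OF that] by (simp add: energy_update_def)
  qed
  have adm: "admissible e s"
    using s(1) min.cobounded1[of 1 "received e / (z * c)", folded s(2)] e0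
    by (auto simp: admissible_def)
  define x where "x = received e / (c * s)"
  have R: "received e = c * s * x" using s(1) c_pos by (simp add: x_def)
  have x: "0 \<le> x" using received_nonneg[OF adm] s(1) c_pos by (simp add: x_def)
  \<comment> \<open>The slope of the affine bound in user \<open>i\<close>'s energy.\<close>
  define k where "k i = g i / (c * (1 + x)) - a i" for i
  have k: "k i \<le> 0" "k i * e i = 0" if "i \<in> I" for i
    using energy_update_slope[OF that a[OF that] s(1) e0, folded e[OF that]]
    by (simp_all add: k_def x_def)
  have lin: "received e' / (c * (1 + x)) - (\<Sum>i\<in>I. a i * e' i) = (\<Sum>i\<in>I. k i * e' i)" for e'
    by (simp add: received_def k_def sum_divide_distrib left_diff_distrib sum_subtractf)
  have dur: "s' * (f_aux x - b) \<le> s * (f_aux x - b)" if "s' \<le> 1" for s'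
  proof (cases "received e / (z * c) < 1")
    case True
    then have "s = received e / (z * c)" using s(2) by simp
    then have "received e = c * s * z" using z c_pos by simp
    then have "x = z" using R s(1) c_pos by simp
    then show ?thesis using z by simp
  next
    case False
    then have "s = 1" "z * c \<le> received e" using z c_pos s(2) by (auto simp: field_simps)
    then have "z \<le> x" using c_pos by (simp add: x_def field_simps)
    then have "b \<le> f_aux x" using f_aux_mono[of z x] z by simp
    then show ?thesis using \<open>s = 1\<close> that mult_right_mono[of s' 1 "f_aux x - b"] by simp
  qed
  have "payoff e' s' \<le> payoff e s" if adm': "admissible e' s'" for e' s'
  proof -
    have s': "0 \<le> s'" "s' \<le> 1" and e': "\<And>i. i \<in> I \<Longrightarrow> 0 \<le> e' i"
      using adm' by (auto simp: admissible_def)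
    have "persp c s' (received e') \<le> s' * f_aux x + received e' / (c * (1 + x))"
      using c_pos s' received_nonneg[OF adm'] x by (intro persp_le_tangent)
    then have "payoff e' s' \<le> s' * (f_aux x - b) + (\<Sum>i\<in>I. k i * e' i)"
      unfolding payoff_def lin[symmetric] by (simp add: algebra_simps)
    also have "\<dots> \<le> s * (f_aux x - b) + 0"
      using dur[OF s'(2)] k e' by (intro add_mono sum_nonpos) (auto simp: mult_nonpos_nonneg)
    also have "\<dots> = s * (f_aux x - b) + (\<Sum>i\<in>I. k i * e i)"
      by (subst sum.neutral) (use k(2) in auto)
    also have "\<dots> = payoff e s"
      unfolding payoff_def lin[symmetric] using persp_eq_tangent[of c s x] c_pos s(1) x
      by (simp add: R algebra_simps)
    finally show ?thesis .
  qed
  with adm show ?thesis by (simp add: best_def)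
qed

end

declare One_nat_def [simp del]

section \<open>Decomposition of the Lagrangian into slots\<close>

lemma sum_mult_partial_sums:
  fixes p q :: "nat \<Rightarrow> real"
  shows "(\<Sum>n=1..T. p n * (\<Sum>t=1..n. q t)) = (\<Sum>t=1..T. (\<Sum>n=t..T. p n) * q t)"
proof (induction T)
  case (Suc T)
  have "(\<Sum>t=1..T. (\<Sum>n=t..Suc T. p n) * q t) = (\<Sum>t=1..T. (\<Sum>n=t..T. p n) * q t + p (Suc T) * q t)"
    by (intro sum.cong) (auto simp: algebra_simps)
  then show ?case using Suc by (simp add: sum.distrib sum_distrib_left algebra_simps)
qed simp

lemma sum_mult_tail_sums:
  fixes p q :: "nat \<Rightarrow> real"
  shows "(\<Sum>i=1..K. p i * (\<Sum>j=i+1..K. q j)) = (\<Sum>j=1..K. q j * (\<Sum>i=1..j-1. p i))"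
proof (induction K)
  case (Suc K)
  have "(\<Sum>i=1..K. p i * (\<Sum>j=i+1..Suc K. q j)) = (\<Sum>i=1..K. p i * (\<Sum>j=i+1..K. q j) + p i * q (Suc K))"
    by (intro sum.cong) (auto simp: algebra_simps)
  then show ?case using Suc by (simp add: sum.distrib sum_distrib_left algebra_simps)
qed simp

text \<open>
  What user \<open>i\<close> sees as interference is the total signal-plus-noise of the later users, so
  each summand is the difference of two consecutive values of \<open>h\<close> and the sum telescopes.
\<close>

lemma sum_log_sic:
  fixes u :: "nat \<Rightarrow> real"
  assumes d: "0 < d" and u: "\<And>i. i \<in> {1..K} \<Longrightarrow> 0 \<le> u i"
  shows "(\<Sum>i=1..K. log 2 (1 + u i / (d + (\<Sum>j=i+1..K. u j)))) = log 2 (1 + (\<Sum>i=1..K. u i) / d)"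
proof -
  define h where "h i = log 2 (d + (\<Sum>j=i..K. u j))" for i
  have pos: "0 < d + (\<Sum>j=i..K. u j)" if "1 \<le> i" for i
    using d u that by (intro add_pos_nonneg sum_nonneg) auto
  have "log 2 (1 + u i / (d + (\<Sum>j=i+1..K. u j))) = h i - h (Suc i)" if i: "i \<in> {1..K}" for i
  proof -
    have eq: "(\<Sum>j=i..K. u j) = u i + (\<Sum>j=i+1..K. u j)"
      using i by (simp add: sum.atLeast_Suc_atMost Suc_eq_plus1)
    have "1 + u i / (d + (\<Sum>j=i+1..K. u j)) = (d + (\<Sum>j=i..K. u j)) / (d + (\<Sum>j=i+1..K. u j))"
      using pos[of "i+1"] by (simp add: eq field_simps)
    then show ?thesis using pos[of i] pos[of "i+1"] i by (simp add: h_def log_divide Suc_eq_plus1)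
  qed
  then have "(\<Sum>i=1..K. log 2 (1 + u i / (d + (\<Sum>j=i+1..K. u j)))) = (\<Sum>i=1..K. h i - h (Suc i))"
    by (intro sum.cong) auto
  also have "\<dots> = - (\<Sum>i=1..K. h (Suc i) - h i)" by (simp add: sum_subtractf)
  also have "\<dots> = h 1 - h (Suc K)" by (subst sum_Suc_diff) auto
  also have "\<dots> = log 2 ((d + (\<Sum>j=1..K. u j)) / d)"
    using pos[of 1] d by (simp add: h_def log_divide)
  also have "(d + (\<Sum>j=1..K. u j)) / d = 1 + (\<Sum>i=1..K. u i) / d"
    using d by (simp add: field_simps)
  finally show ?thesis .
qed

abbreviation slot_payoff ::
  "wpcn \<Rightarrow> (nat \<Rightarrow> nat \<Rightarrow> real) \<Rightarrow> (nat \<Rightarrow> nat \<Rightarrow> real) \<Rightarrow> nat \<Rightarrow> (nat \<Rightarrow> real) \<Rightarrow> real \<Rightarrow> real" where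
  "slot_payoff N lam mu t \<equiv> sic_slot.payoff {1..users N} (\<lambda>i. ul_gain N i t)
     (\<lambda>i. energy_coeff N lam mu i t) (noise N) (time_coeff N lam mu t)"

abbreviation slot_best ::
  "wpcn \<Rightarrow> (nat \<Rightarrow> nat \<Rightarrow> real) \<Rightarrow> (nat \<Rightarrow> nat \<Rightarrow> real) \<Rightarrow> nat \<Rightarrow> (nat \<Rightarrow> real) \<Rightarrow> real \<Rightarrow> bool" where
  "slot_best N lam mu t \<equiv> sic_slot.best {1..users N} (\<lambda>i. ul_gain N i t)
     (\<lambda>i. energy_coeff N lam mu i t) (noise N) (time_coeff N lam mu t)"

lemma sic_slot_wpcn:
  assumes "wf_wpcn N" "t \<in> {1..slots N}"
  shows "sic_slot {1..users N} (\<lambda>i. ul_gain N i t) (noise N)"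
  using assms by unfold_locales (auto simp: wf_wpcn_def)

lemma ln2_sum_rate:
  assumes wf: "wf_wpcn N" and t: "t \<in> {1..slots N}" and "feasible N E tau"
  shows "ln 2 * (\<Sum>i=1..users N. rate N E tau i t) =
    persp (noise N) (1 - tau t) (\<Sum>i=1..users N. ul_gain N i t * E i t)"
proof (cases "tau t = 1")
  case True
  then show ?thesis by (simp add: rate_def persp_def)
next
  case False
  have E: "0 \<le> E i t" if "i \<in> {1..users N}" for i
    using assms that by (auto simp: feasible_def)
  have tau: "tau t < 1" using assms False by (force simp: feasible_def)
  have d: "0 < noise N * (1 - tau t)" using wf tau by (simp add: wf_wpcn_def)
  have u: "0 \<le> ul_gain N i t * E i t" if "i \<in> {1..users N}" for i
    using wf t that E[OF that] by (auto simp: wf_wpcn_def intro!: mult_nonneg_nonneg intro: less_imp_le)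
  have "(\<Sum>i=1..users N. rate N E tau i t) = (1 - tau t) *
      (\<Sum>i=1..users N. log 2 (1 + ul_gain N i t * E i t /
        (noise N * (1 - tau t) + (\<Sum>j=i+1..users N. ul_gain N j t * E j t))))"
    by (simp add: rate_def sinr_def interference_def sum_distrib_left)
  also have "\<dots> = (1 - tau t) * log 2 (1 + (\<Sum>i=1..users N. ul_gain N i t * E i t) / (noise N * (1 - tau t)))"
    using sum_log_sic[OF d u, of "users N" "\<lambda>i. i"] by simp
  finally show ?thesis by (simp add: persp_def log_def)
qed

text \<open>
  The energy of user \<open>j\<close> enters the decoding term of every earlier user \<open>i < j\<close> as interference; swapping
  the two sums turns this into the partial sums of \<open>mu i t * thr N i\<close> in \<open>energy_coeff\<close>.
\<close>

lemma slot_linear_part: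
  fixes N :: wpcn and E :: "nat \<Rightarrow> nat \<Rightarrow> real"
  shows "ln 2 * ((\<Sum>i=1..users N. (\<Sum>n=t..slots N. lam i n) * (harvest_rate N i t * tau t - E i t))
      + (\<Sum>i=1..users N. mu i t * (ul_gain N i t * E i t - thr N i * interference N E tau i t)))
    = ln 2 * (\<Sum>i=1..users N. (\<Sum>n=t..slots N. lam i n) * harvest_rate N i t)
      - time_coeff N lam mu t * (1 - tau t)
      - (\<Sum>i=1..users N. energy_coeff N lam mu i t * E i t)"
proof -
  define L where "L i = (\<Sum>n=t..slots N. lam i n)" for i
  define u where "u i = ul_gain N i t * E i t" for i
  define m where "m i = mu i t * thr N i" for i
  define M where "M i = (\<Sum>j=1..i-1. m j)" for i
  have b: "time_coeff N lam mu t = ln 2 * (noise N * (\<Sum>i=1..users N. m i)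
      + (\<Sum>i=1..users N. L i * harvest_rate N i t))"
    by (simp add: time_coeff_def L_def m_def sum_distrib_right)
  have "energy_coeff N lam mu i t * E i t =
      ln 2 * (L i * E i t + u i * M i - mu i t * u i)" if "i \<in> {1..users N}" for i
  proof (cases "2 \<le> i")
    case False
    then have "i = 1" using that by auto
    then show ?thesis by (simp add: energy_coeff_def L_def u_def M_def algebra_simps)
  qed (simp add: energy_coeff_def L_def u_def M_def m_def algebra_simps)
  then have "(\<Sum>i=1..users N. energy_coeff N lam mu i t * E i t) =
      (\<Sum>i=1..users N. ln 2 * (L i * E i t + u i * M i - mu i t * u i))"
    by (intro sum.cong) auto
  then have a: "(\<Sum>i=1..users N. energy_coeff N lam mu i t * E i t) =
      ln 2 * ((\<Sum>i=1..users N. L i * E i t) + (\<Sum>i=1..users N. u i * M i) - (\<Sum>i=1..users N. mu i t * u i))"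
    by (simp add: sum_distrib_left[symmetric] sum.distrib sum_subtractf)
  have p1: "(\<Sum>i=1..users N. L i * (harvest_rate N i t * tau t - E i t)) =
      (\<Sum>i=1..users N. L i * harvest_rate N i t) * tau t - (\<Sum>i=1..users N. L i * E i t)"
    by (simp add: sum_distrib_right sum_subtractf right_diff_distrib mult.assoc)
  have "mu i t * (u i - thr N i * interference N E tau i t) =
      mu i t * u i - (noise N * (1 - tau t)) * m i - m i * (\<Sum>j=i+1..users N. u j)" for i
    by (simp add: m_def interference_def u_def algebra_simps)
  then have p2: "(\<Sum>i=1..users N. mu i t * (u i - thr N i * interference N E tau i t)) =
      (\<Sum>i=1..users N. mu i t * u i) - (noise N * (1 - tau t)) * (\<Sum>i=1..users N. m i)
      - (\<Sum>i=1..users N. u i * M i)"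
    using sum_mult_tail_sums[of m u "users N"]
    by (simp add: sum_subtractf sum_distrib_left M_def)
  show ?thesis
    unfolding L_def[symmetric] u_def[symmetric] a b p1 p2 by (simp add: algebra_simps)
qed

lemma lagrangian_cleared_slots:
  assumes wf: "wf_wpcn N" and feas: "feasible N E tau"
  shows "ln 2 * lagrangian_cleared N lam mu E tau =
    (\<Sum>t=1..slots N. slot_payoff N lam mu t (\<lambda>i. E i t) (1 - tau t))
    + ln 2 * (\<Sum>t=1..slots N. \<Sum>i=1..users N. (\<Sum>n=t..slots N. lam i n) * harvest_rate N i t)"
proof -
  let ?K = "users N" and ?T = "slots N"
  let ?R = "\<lambda>t. \<Sum>i=1..?K. rate N E tau i t"
  let ?G = "\<lambda>t. \<Sum>i=1..?K. (\<Sum>n=t..?T. lam i n) * harvest_rate N i t"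
  let ?A = "\<lambda>t. \<Sum>i=1..?K. (\<Sum>n=t..?T. lam i n) * (harvest_rate N i t * tau t - E i t)"
  let ?B = "\<lambda>t. \<Sum>i=1..?K. mu i t * (ul_gain N i t * E i t - thr N i * interference N E tau i t)"
  have A: "(\<Sum>i=1..?K. \<Sum>n=1..?T. lam i n * (\<Sum>t=1..n. harvest_rate N i t * tau t - E i t)) = (\<Sum>t=1..?T. ?A t)"
    unfolding sum_mult_partial_sums by (rule sum.swap)
  have B: "(\<Sum>i=1..?K. \<Sum>t=1..?T. mu i t * (ul_gain N i t * E i t - thr N i * interference N E tau i t)) = (\<Sum>t=1..?T. ?B t)"
    by (rule sum.swap)
  have slot: "ln 2 * (?R t + (?A t + ?B t)) = slot_payoff N lam mu t (\<lambda>i. E i t) (1 - tau t) + ln 2 * ?G t"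
    if t: "t \<in> {1..?T}" for t
  proof -
    interpret sic_slot "{1..?K}" "\<lambda>i. ul_gain N i t" "\<lambda>i. energy_coeff N lam mu i t" "noise N"
      "time_coeff N lam mu t" using sic_slot_wpcn[OF wf t] .
    show ?thesis
      unfolding distrib_left[of "ln 2" "?R t"] ln2_sum_rate[OF wf t feas] slot_linear_part
      by (simp add: payoff_def received_def)
  qed
  have "ln 2 * lagrangian_cleared N lam mu E tau = (\<Sum>t=1..?T. ln 2 * (?R t + (?A t + ?B t)))"
    unfolding lagrangian_cleared_def lagrangian_base_def A B
    by (simp add: sum.distrib sum_distrib_left[symmetric])
  also have "\<dots> = (\<Sum>t=1..?T. slot_payoff N lam mu t (\<lambda>i. E i t) (1 - tau t) + ln 2 * ?G t)"
    by (rule sum.cong[OF refl slot])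
  finally show ?thesis by (simp add: sum.distrib sum_distrib_left)
qed

lemma optimal_iff:
  "optimal N L E tau \<longleftrightarrow>
     feasible N E tau \<and> (\<forall>E' tau'. feasible N E' tau' \<longrightarrow> L E' tau' \<le> L E tau)"
  by (auto simp: optimal_def is_arg_max_def not_less)

lemma optimal_cleared_iff_slot_best:
  assumes wf: "wf_wpcn N"
  shows "optimal N (lagrangian_cleared N lam mu) E tau \<longleftrightarrow>
    (\<forall>t\<in>{1..slots N}. slot_best N lam mu t (\<lambda>i. E i t) (1 - tau t))"
proof -
  let ?T = "slots N"
  let ?J = "\<lambda>E tau. \<Sum>t=1..?T. slot_payoff N lam mu t (\<lambda>i. E i t) (1 - tau t)"
  note slot = sic_slot_wpcn[OF wf]
  have best: "slot_best N lam mu t e s \<longleftrightarrow> (0 \<le> s \<and> s \<le> 1 \<and> (\<forall>i\<in>{1..users N}. 0 \<le> e i)) \<and>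
      (\<forall>e' s'. 0 \<le> s' \<and> s' \<le> 1 \<and> (\<forall>i\<in>{1..users N}. 0 \<le> e' i) \<longrightarrow>
         slot_payoff N lam mu t e' s' \<le> slot_payoff N lam mu t e s)"
    if "t \<in> {1..?T}" for t e s
    unfolding sic_slot.best_def[OF slot[OF that]] sic_slot.admissible_def[OF slot[OF that]] ..
  have "ln 2 * lagrangian_cleared N lam mu E' tau' \<le> ln 2 * lagrangian_cleared N lam mu E tau
      \<longleftrightarrow> ?J E' tau' \<le> ?J E tau" if "feasible N E tau" "feasible N E' tau'" for E' tau'
    unfolding lagrangian_cleared_slots[OF wf that(1)] lagrangian_cleared_slots[OF wf that(2)] by simp
  then have opt: "optimal N (lagrangian_cleared N lam mu) E tau \<longleftrightarrow>
      feasible N E tau \<and> (\<forall>E' tau'. feasible N E' tau' \<longrightarrow> ?J E' tau' \<le> ?J E tau)"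
    unfolding optimal_iff by auto
  show ?thesis
  proof
    assume "optimal N (lagrangian_cleared N lam mu) E tau"
    then have feas: "feasible N E tau"
      and J: "\<And>E' tau'. feasible N E' tau' \<Longrightarrow> ?J E' tau' \<le> ?J E tau" unfolding opt by auto
    show "\<forall>t\<in>{1..?T}. slot_best N lam mu t (\<lambda>i. E i t) (1 - tau t)"
    proof
      fix t assume t: "t \<in> {1..?T}"
      have "slot_payoff N lam mu t e' s' \<le> slot_payoff N lam mu t (\<lambda>i. E i t) (1 - tau t)"
        if "0 \<le> s'" "s' \<le> 1" "\<forall>i\<in>{1..users N}. 0 \<le> e' i" for e' s'
      proof -
        define E' where "E' i = (E i)(t := e' i)" for i
        define tau' where "tau' = tau(t := 1 - s')"
        have "feasible N E' tau'" using feas that by (auto simp: feasible_def E'_def tau'_def)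
        from J[OF this] show ?thesis
          unfolding sum.remove[OF finite_atLeastAtMost t] by (simp add: E'_def tau'_def)
      qed
      then show "slot_best N lam mu t (\<lambda>i. E i t) (1 - tau t)"
        unfolding best[OF t] using feas t by (auto simp: feasible_def)
    qed
  next
    assume R: "\<forall>t\<in>{1..?T}. slot_best N lam mu t (\<lambda>i. E i t) (1 - tau t)"
    have "feasible N E tau" using R best by (fastforce simp: feasible_def)
    moreover have "?J E' tau' \<le> ?J E tau" if "feasible N E' tau'" for E' tau'
    proof (rule sum_mono)
      fix t assume t: "t \<in> {1..?T}"
      show "slot_payoff N lam mu t (\<lambda>i. E' i t) (1 - tau' t)
          \<le> slot_payoff N lam mu t (\<lambda>i. E i t) (1 - tau t)"
        using bspec[OF R t] that t unfolding best[OF t] by (auto simp: feasible_def)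
    qed
    ultimately show "optimal N (lagrangian_cleared N lam mu) E tau" unfolding opt by simp
  qed
qed

section \<open>Closed form of the optimal allocation\<close>

lemma harvest_rate_pos:
  "wf_wpcn N \<Longrightarrow> i \<in> {1..users N} \<Longrightarrow> t \<in> {1..slots N} \<Longrightarrow> 0 < harvest_rate N i t"
  by (simp add: wf_wpcn_def harvest_rate_def)

lemma time_coeff_nonneg:
  assumes "wf_wpcn N" "\<forall>i\<in>{1..users N}. \<forall>t\<in>{1..slots N}. 0 \<le> lam i t"
    "\<forall>i\<in>{1..users N}. \<forall>t\<in>{1..slots N}. 0 \<le> mu i t" "t \<in> {1..slots N}"
  shows "0 \<le> time_coeff N lam mu t"
  unfolding time_coeff_def using assms harvest_rate_pos[OF assms(1)]
  by (intro mult_nonneg_nonneg add_nonneg_nonneg sum_nonneg) (auto simp: wf_wpcn_def less_imp_le)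

text \<open>
  User 1 is decoded first and its signal disturbs nobody, so its energy price can be positive only through
  its \<open>lam\<close> multipliers, and these enter the time coefficient with the positive harvesting rate.
\<close>

lemma time_coeff_pos:
  assumes wf: "wf_wpcn N" and lam: "\<forall>i\<in>{1..users N}. \<forall>t\<in>{1..slots N}. 0 \<le> lam i t"
    and mu: "\<forall>i\<in>{1..users N}. \<forall>t\<in>{1..slots N}. 0 \<le> mu i t" and t: "t \<in> {1..slots N}"
    and a: "0 < energy_coeff N lam mu 1 t"
  shows "0 < time_coeff N lam mu t"
proof -
  have K: "1 \<in> {1..users N}" using wf by (simp add: wf_wpcn_def)
  have h: "0 < harvest_rate N 1 t" using harvest_rate_pos[OF wf K t] .
  have "0 \<le> mu 1 t * ul_gain N 1 t" using wf mu t K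
    by (intro mult_nonneg_nonneg) (auto simp: wf_wpcn_def less_imp_le)
  then have "0 < (\<Sum>n=t..slots N. lam 1 n)" using a by (simp add: energy_coeff_def zero_less_mult_iff)
  then have "0 < (\<Sum>n=t..slots N. lam 1 n * harvest_rate N 1 t)"
    using h by (simp add: sum_distrib_right[symmetric])
  also have "\<dots> \<le> (\<Sum>i=1..users N. \<Sum>n=t..slots N. lam i n * harvest_rate N i t)"
    using K lam t harvest_rate_pos[OF wf]
    by (intro member_le_sum[of 1 _ "\<lambda>i. \<Sum>n=t..slots N. lam i n * harvest_rate N i t"] sum_nonneg)
       (auto intro!: mult_nonneg_nonneg intro: less_imp_le)
  finally have "0 < (\<Sum>i=1..users N. \<Sum>n=t..slots N. lam i n * harvest_rate N i t)" .
  moreover have "0 \<le> noise N * (\<Sum>i=1..users N. mu i t * thr N i)"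
    using wf mu t by (intro mult_nonneg_nonneg sum_nonneg) (auto simp: wf_wpcn_def)
  ultimately show ?thesis by (simp add: time_coeff_def add_nonneg_pos)
qed

lemma z_star:
  assumes "0 \<le> time_coeff N lam mu t"
  shows "0 \<le> z_star N lam mu t" and "f_aux (z_star N lam mu t) = time_coeff N lam mu t"
  using theI'[OF ex1_f_aux[OF assms]] by (auto simp: z_star_def)

lemma time_formula_iff:
  assumes wf: "wf_wpcn N" and t: "t \<in> {1..slots N}" and z: "0 < z_star N lam mu t"
    and E: "\<forall>i\<in>{1..users N}. 0 \<le> E i t"
  shows "tau t = time_formula N lam mu E t \<longleftrightarrow>
    1 - tau t = min 1 (sic_slot.received {1..users N} (\<lambda>i. ul_gain N i t) (\<lambda>i. E i t) / (z_star N lam mu t * noise N))"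
proof -
  interpret sic_slot "{1..users N}" "\<lambda>i. ul_gain N i t" "\<lambda>i. energy_coeff N lam mu i t" "noise N"
    "time_coeff N lam mu t" using sic_slot_wpcn[OF wf t] .
  have "0 \<le> received (\<lambda>i. E i t)" using received_nonneg[of "\<lambda>i. E i t" 0] E by (simp add: admissible_def)
  then have "0 \<le> received (\<lambda>i. E i t) / (z_star N lam mu t * noise N)" using z c_pos by simp
  then show ?thesis by (auto simp: time_formula_def received_def)
qed

lemma slot_best_imp_closed_form:
  assumes wf: "wf_wpcn N" and lam: "\<forall>i\<in>{1..users N}. \<forall>t\<in>{1..slots N}. 0 \<le> lam i t"
    and mu: "\<forall>i\<in>{1..users N}. \<forall>t\<in>{1..slots N}. 0 \<le> mu i t"
    and best: "\<forall>t\<in>{1..slots N}. slot_best N lam mu t (\<lambda>i. E i t) (1 - tau t)"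
  shows "closed_form N lam mu E tau"
proof -
  have "0 < z_star N lam mu t \<and> tau t = time_formula N lam mu E t \<and>
      (\<forall>i\<in>{1..users N}. 0 < energy_coeff N lam mu i t \<and> E i t = energy_formula N lam mu E tau i t)"
    if t: "t \<in> {1..slots N}" for t
  proof -
    interpret sic_slot "{1..users N}" "\<lambda>i. ul_gain N i t" "\<lambda>i. energy_coeff N lam mu i t" "noise N"
      "time_coeff N lam mu t" using sic_slot_wpcn[OF wf t] .
    have bst: "best (\<lambda>i. E i t) (1 - tau t)" using best t by simp
    note a = energy_price_pos[OF bst]
    have b: "0 < time_coeff N lam mu t"
      using wf by (intro time_coeff_pos[OF wf lam mu t] a) (simp add: wf_wpcn_def)
    note zs = z_star[OF less_imp_le[OF b]]
    have z: "0 < z_star N lam mu t" using zs b by (cases "z_star N lam mu t = 0") auto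
    have E: "\<forall>i\<in>{1..users N}. 0 \<le> E i t" using bst by (simp add: best_def admissible_def)
    show ?thesis
    proof (intro conjI ballI)
      show "tau t = time_formula N lam mu E t"
        unfolding time_formula_iff[where E = E, OF wf t z E] by (rule best_duration[OF bst b z zs(2)])
      show "E i t = energy_formula N lam mu E tau i t" if "i \<in> {1..users N}" for i
        using best_energy[OF bst that] unfolding energy_update_def energy_formula_def by (rule trans) simp
    qed (fact z a)+
  qed
  then show ?thesis by (auto simp: closed_form_def)
qed

lemma closed_form_imp_slot_best:
  assumes wf: "wf_wpcn N" and lam: "\<forall>i\<in>{1..users N}. \<forall>t\<in>{1..slots N}. 0 \<le> lam i t"
    and mu: "\<forall>i\<in>{1..users N}. \<forall>t\<in>{1..slots N}. 0 \<le> mu i t"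
    and cf: "closed_form N lam mu E tau" and t: "t \<in> {1..slots N}" and tau: "tau t < 1"
  shows "slot_best N lam mu t (\<lambda>i. E i t) (1 - tau t)"
proof -
  interpret sic_slot "{1..users N}" "\<lambda>i. ul_gain N i t" "\<lambda>i. energy_coeff N lam mu i t" "noise N"
    "time_coeff N lam mu t" using sic_slot_wpcn[OF wf t] .
  note zs = z_star[OF time_coeff_nonneg[OF wf lam mu t]]
  have z: "0 < z_star N lam mu t" and tf: "tau t = time_formula N lam mu E t"
    and a: "\<And>i. i \<in> {1..users N} \<Longrightarrow> 0 < energy_coeff N lam mu i t"
    and ef: "\<And>i. i \<in> {1..users N} \<Longrightarrow> E i t = energy_formula N lam mu E tau i t"
    using cf t by (auto simp: closed_form_def)
  have E: "\<forall>i\<in>{1..users N}. 0 \<le> E i t"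
  proof
    show "0 \<le> E i t" if "i \<in> {1..users N}" for i
      unfolding ef[OF that] by (simp add: energy_formula_def)
  qed
  show ?thesis
  proof (rule best_if_stationary[OF a z zs(2)])
    show "1 - tau t = min 1 (received (\<lambda>i. E i t) / (z_star N lam mu t * noise N))"
      using tf unfolding time_formula_iff[where E = E, OF wf t z E] .
    show "E i t = energy_update (\<lambda>i. E i t) (1 - tau t) i" if "i \<in> {1..users N}" for i
      using ef[OF that] unfolding energy_update_def energy_formula_def by (rule trans) simp
  qed (use tau in auto)
qed

section \<open>The Lagrangian with fractional decoding constraints\<close>

lemma sinr_nonneg:
  assumes wf: "wf_wpcn N" and feas: "feasible N E tau"
    and i: "i \<in> {1..users N}" and t: "t \<in> {1..slots N}"
  shows "0 \<le> sinr N E tau i t"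
proof -
  have u: "0 \<le> ul_gain N j t * E j t" if "j \<in> {1..users N}" for j
    using wf feas t that
    by (intro mult_nonneg_nonneg) (auto simp: wf_wpcn_def feasible_def less_imp_le)
  have "0 \<le> noise N * (1 - tau t)" using wf feas t by (auto simp: wf_wpcn_def feasible_def)
  moreover have "0 \<le> (\<Sum>j=i+1..users N. ul_gain N j t * E j t)" using u by (intro sum_nonneg) auto
  ultimately show ?thesis using u[OF i] by (simp add: sinr_def interference_def)
qed

text \<open>
  Only user \<open>i0\<close> sends, one unit of energy in slot \<open>t0\<close>, and all slots have transmission time \<open>eps\<close>. The
  ratio of that user is then inversely proportional to \<open>eps\<close>, while the remaining terms are bounded
  below by a constant \<open>C\<close> independent of \<open>eps\<close>.
\<close>

lemma lagrangian_unbounded: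
  assumes wf: "wf_wpcn N" and lam: "\<forall>i\<in>{1..users N}. \<forall>t\<in>{1..slots N}. 0 \<le> lam i t"
    and mu: "\<forall>i\<in>{1..users N}. \<forall>t\<in>{1..slots N}. 0 \<le> mu i t"
    and i0: "i0 \<in> {1..users N}" and t0: "t0 \<in> {1..slots N}" and pos: "0 < mu i0 t0"
  shows "\<exists>E tau. feasible N E tau \<and> B < lagrangian N lam mu E tau"
proof -
  let ?K = "users N" and ?T = "slots N"
  define E where "E i t = (if i = i0 \<and> t = t0 then 1 else 0 :: real)" for i t
  define C where "C = (\<Sum>i=1..?K. \<Sum>n=1..?T. lam i n * (\<Sum>t=1..n. - E i t))
    + (\<Sum>i=1..?K. \<Sum>t=1..?T. mu i t * (- thr N i))"
  define q where "q = mu i0 t0 * (ul_gain N i0 t0 / noise N)"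
  have q: "0 < q" using pos wf i0 t0 by (simp add: q_def wf_wpcn_def)
  define eps where "eps = min 1 (q / (\<bar>B - C\<bar> + 1))"
  define tau where "tau = (\<lambda>t::nat. 1 - eps)"
  have eps: "0 < eps" "eps \<le> 1" using q by (auto simp: eps_def)
  have "\<bar>B - C\<bar> + 1 \<le> q / eps"
  proof -
    have "eps \<le> q / (\<bar>B - C\<bar> + 1)" by (simp add: eps_def)
    then show ?thesis using eps by (simp add: field_simps)
  qed
  then have big: "B < C + q / eps" by linarith
  have feas: "feasible N E tau" using eps by (auto simp: feasible_def E_def tau_def)
  note sinr = sinr_nonneg[OF wf feas]
  have rates: "0 \<le> (\<Sum>t=1..?T. \<Sum>i=1..?K. rate N E tau i t)"
  proof (intro sum_nonneg)
    fix t i assume "t \<in> {1..?T}" "i \<in> {1..?K}"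
    then have "0 \<le> sinr N E tau i t" by (intro sinr)
    then have "0 \<le> log 2 (1 + sinr N E tau i t)" by simp
    then show "0 \<le> rate N E tau i t" using eps by (simp add: rate_def tau_def)
  qed
  have energy: "(\<Sum>i=1..?K. \<Sum>n=1..?T. lam i n * (\<Sum>t=1..n. - E i t)) \<le>
      (\<Sum>i=1..?K. \<Sum>n=1..?T. lam i n * (\<Sum>t=1..n. harvest_rate N i t * tau t - E i t))"
  proof (intro sum_mono mult_left_mono)
    fix i n t assume "i \<in> {1..?K}" "n \<in> {1..?T}" "t \<in> {1..n}"
    then have "0 < harvest_rate N i t" by (intro harvest_rate_pos[OF wf]) auto
    then show "- E i t \<le> harvest_rate N i t * tau t - E i t" using eps by (simp add: tau_def)
  qed (use lam in auto)
  have ms: "0 \<le> mu i t * sinr N E tau i t" if "i \<in> {1..?K}" "t \<in> {1..?T}" for i t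
    using mu sinr that by auto
  have "interference N E tau i0 t0 = noise N * eps"
    by (simp add: interference_def tau_def E_def)
  then have "q / eps = mu i0 t0 * sinr N E tau i0 t0"
    by (simp add: q_def sinr_def E_def)
  also have "\<dots> \<le> (\<Sum>t=1..?T. mu i0 t * sinr N E tau i0 t)"
    using ms i0 t0 by (intro member_le_sum[of t0 _ "\<lambda>t. mu i0 t * sinr N E tau i0 t"]) auto
  also have "\<dots> \<le> (\<Sum>i=1..?K. \<Sum>t=1..?T. mu i t * sinr N E tau i t)"
    using ms i0 by (intro member_le_sum[of i0 _ "\<lambda>i. \<Sum>t=1..?T. mu i t * sinr N E tau i t"] sum_nonneg) auto
  finally have "(\<Sum>i=1..?K. \<Sum>t=1..?T. mu i t * (- thr N i)) + q / eps
      \<le> (\<Sum>i=1..?K. \<Sum>t=1..?T. mu i t * (sinr N E tau i t - thr N i))"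
    by (simp add: right_diff_distrib sum_subtractf sum_negf)
  then have "C + q / eps \<le> lagrangian N lam mu E tau"
    using rates energy unfolding lagrangian_def lagrangian_base_def C_def by linarith
  with big feas show ?thesis by (meson less_le_trans)
qed

lemma optimal_lagrangian_imp_cleared:
  assumes wf: "wf_wpcn N" and lam: "\<forall>i\<in>{1..users N}. \<forall>t\<in>{1..slots N}. 0 \<le> lam i t"
    and mu: "\<forall>i\<in>{1..users N}. \<forall>t\<in>{1..slots N}. 0 \<le> mu i t"
    and opt: "optimal N (lagrangian N lam mu) E tau"
  shows "optimal N (lagrangian_cleared N lam mu) E tau"
proof -
  have "mu i t = 0" if "i \<in> {1..users N}" "t \<in> {1..slots N}" for i t
  proof (rule ccontr)
    assume "mu i t \<noteq> 0"
    then have "0 < mu i t" using mu that by (metis order_le_less)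
    from lagrangian_unbounded[OF wf lam mu that this, of "lagrangian N lam mu E tau"]
    show False using opt by (auto simp: optimal_iff not_less[symmetric])
  qed
  then have "lagrangian N lam mu E' tau' = lagrangian_cleared N lam mu E' tau'" for E' tau'
    by (simp add: lagrangian_def lagrangian_cleared_def)
  with opt show ?thesis by (simp add: optimal_iff)
qed

theorem mainTheorem2:
  fixes N :: wpcn and lam mu :: "nat \<Rightarrow> nat \<Rightarrow> real"
  assumes "wf_wpcn N"
    and "\<forall>i\<in>{1..users N}. \<forall>t\<in>{1..slots N}. 0 \<le> lam i t"
    and "\<forall>i\<in>{1..users N}. \<forall>t\<in>{1..slots N}. 0 \<le> mu i t"
  shows "(\<forall>t\<in>{1..slots N}. \<exists>!z. 0 \<le> z \<and> f_aux z = time_coeff N lam mu t) \<and>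
    (\<forall>E tau. optimal N (lagrangian N lam mu) E tau \<longrightarrow> closed_form N lam mu E tau) \<and>
    (\<forall>E tau. optimal N (lagrangian_cleared N lam mu) E tau \<longrightarrow> closed_form N lam mu E tau) \<and>
    (\<forall>E tau. closed_form N lam mu E tau \<and> (\<forall>t\<in>{1..slots N}. tau t < 1)
       \<longrightarrow> optimal N (lagrangian_cleared N lam mu) E tau)"
proof -
  have cleared: "closed_form N lam mu E tau"
    if "optimal N (lagrangian_cleared N lam mu) E tau" for E tau
    using slot_best_imp_closed_form[OF assms] that
    unfolding optimal_cleared_iff_slot_best[OF assms(1)] .
  moreover have "closed_form N lam mu E tau" if "optimal N (lagrangian N lam mu) E tau" for E tau
    using cleared optimal_lagrangian_imp_cleared[OF assms that] .
  moreover have "optimal N (lagrangian_cleared N lam mu) E tau"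
    if "closed_form N lam mu E tau" "\<forall>t\<in>{1..slots N}. tau t < 1" for E tau
    using closed_form_imp_slot_best[OF assms] that
    unfolding optimal_cleared_iff_slot_best[OF assms(1)] by blast
  moreover have "\<exists>!z. 0 \<le> z \<and> f_aux z = time_coeff N lam mu t" if "t \<in> {1..slots N}" for t
    using ex1_f_aux time_coeff_nonneg[OF assms that] .
  ultimately show ?thesis by blast
qed

end
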